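(* Let $T>0$, let $X:[0,T]^2\to\mathbb{R}^d$ be a $C^2$ field and $\mathbf S(X)$ its full 2D signature. Let $n\le3$, let $w=(i_1,\dots,i_n)$ be a word in $\{1,\dots,d\}$ and $\nu$ a permutation of $\{1,\dots,n\}$. Then for all $\mathbf s=(s_1,s_2),\mathbf t=(t_1,t_2)\in[0,T]^2$ with $s_1\le t_1$, $s_2\le t_2$, $$\langle\mathbf S_{\mathbf s\mathbf t}(X),(w,\nu)\rangle=\mathbf 1_{\{w=\mathsf e\}}+\mathbf 1_{\{w\neq\mathsf e\}}\int_{[\mathbf s,\mathbf t]}\mathcal L_{\mathbf v}^{\mathbf s\mathbf t;(i_1\dots i_{n-1},\nu)}\,dX^{i_n}_{\mathbf v},$$ where $\mathsf e$ is the empty word and, with $\mathbf v=(v_1,v_2)$ and $\mathbf S_{a,b;c,d'}:=\mathbf S_{(a,b),(c,d')}$, $$\begin{aligned} \mathcal L_{\mathbf v}^{\mathbf s\mathbf t;(\mathsf e,[1])}&=1,\\ \mathcal L_{\mathbf v}^{\mathbf s\mathbf t;(i_1,[12])}&=\langle\mathbf S_{s_1,s_2;v_1,v_2}(X),((i_1),\mathrm{id})\rangle,\\ \mathcal L_{\mathbf v}^{\mathbf s\mathbf t;(i_1,[21])}&=\langle\mathbf S_{s_1,v_2;v_1,t_2}(X),((i_1),\mathrm{id})\rangle,\\ \mathcal L_{\mathbf v}^{\mathbf s\mathbf t;(i_1i_2,[123])}&=\langle\mathbf S_{s_1,s_2;v_1,v_2}(X),((i_1,i_2),\mathrm{id})\rangle,\\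 \mathcal L_{\mathbf v}^{\mathbf s\mathbf t;(i_1i_2,[132])}&=\langle\mathbf S_{s_1,s_2;v_1,t_2}(X),((i_1,i_2),\mathrm{id})\rangle-\langle\mathbf S_{s_1,s_2;v_1,v_2}(X),((i_1,i_2),\mathrm{id})\rangle-\langle\mathbf S_{s_1,v_2;v_1,t_2}(X),((i_1,i_2),\mathrm{id})\rangle,\\ \mathcal L_{\mathbf v}^{\mathbf s\mathbf t;(i_1i_2,[213])}&=\langle\mathbf S_{s_1,s_2;v_1,v_2}(X),((i_1,i_2),[21])\rangle,\\ \mathcal L_{\mathbf v}^{\mathbf s\mathbf t;(i_1i_2,[231])}&=\langle\mathbf S_{s_1,v_2;v_1,t_2}(X),((i_1,i_2),[12])\rangle,\\ \mathcal L_{\mathbf v}^{\mathbf s\mathbf t;(i_1i_2,[321])}&=\langle\mathbf S_{s_1,v_2;v_1,t_2}(X),((i_1,i_2),[21])\rangle,\\ \mathcal L_{\mathbf v}^{\mathbf s\mathbf t;(i_1i_2,[312])}&=\langle\mathbf S_{s_1,s_2;v_1,t_2}(X),((i_1,i_2),[21])\rangle-\langle\mathbf S_{s_1,s_2;v_1,v_2}(X),((i_1,i_2),[21])\rangle-\langle\mathbf S_{s_1,v_2;v_1,t_2}(X),((i_1,i_2),[21])\rangle. \end{aligned}$$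
   Context: Permutations are in one-line notation $[\nu(1)\,\nu(2)\cdots\nu(n)]$; $\mathrm{id}$ is the identity permutation. $[\mathbf s,\mathbf t]=[s_1,t_1]\times[s_2,t_2]$. $dX^i_{\mathbf v}=\partial_{12}X^i(v_1,v_2)\,dv_1dv_2$ with $\partial_{12}=\frac{\partial^2}{\partial r_1\partial r_2}$. Full 2D signature: for a word $w=(w_1,\dots,w_n)$ in $\{1,\dots,d\}$ and a permutation $\nu$ of $\{1,\dots,n\}$, $$\langle \mathbf S_{\mathbf s\mathbf t}(X),(w,\nu)\rangle=\int_{\Delta^n_{[\mathbf s,\mathbf t]}}\prod_{i=1}^n\partial_{12}X^{w_i}(r_1^i,r_2^{\nu(i)})\,d\mathbf r^1\cdots d\mathbf r^n,$$ where $\mathbf r^i=(r_1^i,r_2^i)$ and $\Delta^n_{[\mathbf s,\mathbf t]}=\{(\mathbf r^1,\dots,\mathbf r^n): s_1\le r_1^1\le\dots\le r_1^n\le t_1,\ s_2\le r_2^1\le\dots\le r_2^n\le t_2\}$; for the empty word ($n=0$) the value is $1$. *)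

theory Defs
  imports "HOL-Analysis.Analysis" "HOL-Combinatorics.Multiset_Permutations"
begin

text \<open>
  Partial derivatives on the closed square \<open>[0,T]\<^sup>2\<close>; on the boundary they are one-sided, so that they
  depend only on the values of the field on the square.
\<close>

definition partial1 :: "real \<Rightarrow> (real \<times> real \<Rightarrow> 'a::real_normed_vector) \<Rightarrow> real \<times> real \<Rightarrow> 'a" where
  "partial1 T f = (\<lambda>(x, y). vector_derivative (\<lambda>a. f (a, y)) (at x within {0..T}))"

definition partial2 :: "real \<Rightarrow> (real \<times> real \<Rightarrow> 'a::real_normed_vector) \<Rightarrow> real \<times> real \<Rightarrow> 'a" where
  "partial2 T f = (\<lambda>(x, y). vector_derivative (\<lambda>b. f (x, b)) (at y within {0..T}))"

definition partial12 :: "real \<Rightarrow> (real \<times> real \<Rightarrow> 'a::real_normed_vector) \<Rightarrow> real \<times> real \<Rightarrow> 'a" where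
  "partial12 T f = partial1 T (partial2 T f)"

definition C1_square :: "real \<Rightarrow> (real \<times> real \<Rightarrow> 'a::real_normed_vector) \<Rightarrow> bool" where
  "C1_square T f \<longleftrightarrow>
     (\<forall>x\<in>{0..T}. \<forall>y\<in>{0..T}.
        (\<lambda>a. f (a, y)) differentiable (at x within {0..T}) \<and>
        (\<lambda>b. f (x, b)) differentiable (at y within {0..T})) \<and>
     continuous_on ({0..T} \<times> {0..T}) (partial1 T f) \<and>
     continuous_on ({0..T} \<times> {0..T}) (partial2 T f)"

definition C2_square :: "real \<Rightarrow> (real \<times> real \<Rightarrow> 'a::real_normed_vector) \<Rightarrow> bool" where
  "C2_square T f \<longleftrightarrow> C1_square T f \<and> C1_square T (partial1 T f) \<and> C1_square T (partial2 T f)"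

text \<open>
  Points \<open>(\<^bold>r\<^sup>1, \<dots>, \<^bold>r\<^sup>n)\<close> of \<open>(\<real>\<^sup>2)\<^sup>n\<close> are functions on \<open>{1..n}\<close>, with Lebesgue measure the product
  measure \<open>\<Pi>\<^sub>M i\<in>{1..n}. lborel\<close>. Both coordinates are ordered increasingly.
\<close>

definition simplex2 :: "nat \<Rightarrow> real \<times> real \<Rightarrow> real \<times> real \<Rightarrow> (nat \<Rightarrow> real \<times> real) set" where
  "simplex2 n s t =
     {r \<in> {1..n} \<rightarrow>\<^sub>E UNIV.
        (\<forall>i\<in>{1..n}. fst s \<le> fst (r i) \<and> fst (r i) \<le> fst t \<and>
                    snd s \<le> snd (r i) \<and> snd (r i) \<le> snd t) \<and>
        (\<forall>i\<in>{1..n}. \<forall>j\<in>{1..n}. i \<le> j \<longrightarrow> fst (r i) \<le> fst (r j) \<and> snd (r i) \<le> snd (r j))}"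

text \<open>
  The coefficient \<open>\<langle>\<^bold>S\<^sub>s\<^sub>t(X), (w, \<nu>)\<rangle>\<close>. The permutation \<open>\<nu>\<close> of \<open>{1..n}\<close> is given by its one-line
  notation, a list in \<^term>\<open>permutations_of_set {1..n}\<close>; since lists are indexed from \<open>0\<close>,
  \<open>w\<^sub>i\<close> and \<open>\<nu>(i)\<close> are \<open>w ! (i - 1)\<close> and \<open>\<nu> ! (i - 1)\<close>.
\<close>

definition sig2 ::
    "real \<Rightarrow> (real \<times> real \<Rightarrow> real ^ 'd) \<Rightarrow> real \<times> real \<Rightarrow> real \<times> real \<Rightarrow> 'd list \<Rightarrow> nat list \<Rightarrow> real" where
  "sig2 T X s t w \<nu> =
     (if w = [] then 1
      else LINT r : simplex2 (length w) s t | (\<Pi>\<^sub>M i\<in>{1..length w}. lborel).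
             (\<Prod>i\<in>{1..length w}.
                partial12 T (\<lambda>p. X p $ (w ! (i - 1))) (fst (r i), snd (r (\<nu> ! (i - 1))))))"

text \<open>
  \<open>sig_kernel T X s t u \<nu> v\<close> is \<open>\<L>\<^sub>v\<close> for the word \<open>u = i\<^sub>1\<dots>i\<^sub>n\<^sub>-\<^sub>1\<close> and the permutation \<open>\<nu>\<close> of \<open>{1..n}\<close>,
  \<open>1 \<le> n \<le> 3\<close>. The length of \<open>u\<close> is determined by \<open>\<nu>\<close>; the value \<open>0\<close> for all other \<open>\<nu>\<close> is a dummy.
\<close>

fun sig_kernel ::
    "real \<Rightarrow> (real \<times> real \<Rightarrow> real ^ 'd) \<Rightarrow> real \<times> real \<Rightarrow> real \<times> real \<Rightarrow> 'd list \<Rightarrow> nat list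
      \<Rightarrow> real \<times> real \<Rightarrow> real" where
  "sig_kernel T X (s1, s2) (t1, t2) u \<nu> (v1, v2) =
     (if \<nu> = [1] then 1
      else if \<nu> = [1,2] then sig2 T X (s1, s2) (v1, v2) u [1]
      else if \<nu> = [2,1] then sig2 T X (s1, v2) (v1, t2) u [1]
      else if \<nu> = [1,2,3] then sig2 T X (s1, s2) (v1, v2) u [1,2]
      else if \<nu> = [1,3,2] then
        sig2 T X (s1, s2) (v1, t2) u [1,2] - sig2 T X (s1, s2) (v1, v2) u [1,2]
          - sig2 T X (s1, v2) (v1, t2) u [1,2]
      else if \<nu> = [2,1,3] then sig2 T X (s1, s2) (v1, v2) u [2,1]
      else if \<nu> = [2,3,1] then sig2 T X (s1, v2) (v1, t2) u [1,2]
      else if \<nu> = [3,2,1] then sig2 T X (s1, v2) (v1, t2) u [2,1]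
      else if \<nu> = [3,1,2] then
        sig2 T X (s1, s2) (v1, t2) u [2,1] - sig2 T X (s1, s2) (v1, v2) u [2,1]
          - sig2 T X (s1, v2) (v1, t2) u [2,1]
      else 0)"

end

theory Submission
  imports Defs
begin

text \<open>
  Reindexing the second coordinates by \<open>\<nu>\<close> preserves Lebesgue measure, so with
  \<open>p\<^sub>i = (r\<^sub>1\<^sup>i, r\<^sub>2\<^sup>\<nu>\<^sup>(\<^sup>i\<^sup>))\<close> the coefficient is the integral of a genuine product
  \<open>\<Prod>\<^sub>i \<partial>\<^sub>1\<^sub>2X(p\<^sub>i)\<close> over points whose abscissae increase in \<open>i\<close> and whose ordinates are ordered like \<open>\<nu>\<close>.
  By Fubini the last point \<open>v = p\<^sub>n\<close> is integrated last. It has the largest abscissa, and its ordinate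
  bounds the other ordinates from above or below according to whether \<open>\<nu>\<close> is smaller or larger there than
  at \<open>n\<close>. If \<open>\<nu>(n)\<close> is extremal, the section at \<open>v\<close> is thus a region of the same kind in a smaller
  rectangle; for \<open>n = 3\<close>, \<open>\<nu>(3) = 2\<close> it is, up to a null set, a difference of such regions.
\<close>

section \<open>Permuted coordinates and iterated integrals for product measures\<close>

text \<open>A measure on the product is determined by its values on boxes
  \<open>Pi\<^sub>E I A\<close>. For fixed abscissae, the indicator of a box is a product with one
  factor per ordinate, so its integral is a product of section measures, and permuting the ordinates
  only reorders the factors. The \<open>A i\<close> are arbitrary measurable sets of pairs, which is
  why sections appear.\<close>

lemma distr_PiM_pair_reindex:
  assumes M: "sigma_finite_measure M1" "sigma_finite_measure M2"
    and I: "finite I" and \<pi>: "bij_betw \<pi> I I"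
  shows "distr ((\<Pi>\<^sub>M i\<in>I. M1) \<Otimes>\<^sub>M (\<Pi>\<^sub>M i\<in>I. M2)) (\<Pi>\<^sub>M i\<in>I. M1 \<Otimes>\<^sub>M M2)
           (\<lambda>(x, y). \<lambda>i\<in>I. (x i, y (\<pi> i))) = (\<Pi>\<^sub>M i\<in>I. M1 \<Otimes>\<^sub>M M2)"
proof -
  interpret pair_sigma_finite M1 M2
    using M by (simp add: pair_sigma_finite_def)
  interpret P1: product_sigma_finite "\<lambda>_. M1"
    by (simp add: product_sigma_finite_def M)
  interpret P2: product_sigma_finite "\<lambda>_. M2"
    by (simp add: product_sigma_finite_def M)
  interpret P: product_sigma_finite "\<lambda>_. M1 \<Otimes>\<^sub>M M2"
    by (simp add: product_sigma_finite_def sigma_finite_measure_axioms)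
  interpret PP2: sigma_finite_measure "\<Pi>\<^sub>M i\<in>I. M2"
    using I by (rule P2.sigma_finite)
  have mem: "\<pi> i \<in> I" if "i \<in> I" for i
    using \<pi> that by (rule bij_betwE[rule_format])
  let ?J = "\<lambda>(x, y). \<lambda>i\<in>I. (x i, y (\<pi> i))"
  have J: "?J \<in> (\<Pi>\<^sub>M i\<in>I. M1) \<Otimes>\<^sub>M (\<Pi>\<^sub>M i\<in>I. M2) \<rightarrow>\<^sub>M (\<Pi>\<^sub>M i\<in>I. M1 \<Otimes>\<^sub>M M2)"
    using mem by measurable
  show ?thesis
  proof (rule P.PiM_eqI)
    fix A assume A: "\<And>i. i \<in> I \<Longrightarrow> A i \<in> sets (M1 \<Otimes>\<^sub>M M2)"
    \<comment> \<open>The inverse of \<pi>: writing \<open>j = \<pi> i\<close> turns the factor in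
      \<open>(x i, y (\<pi> i))\<close> into one in \<open>(x (\<rho> j), y j)\<close>, so that each
      ordinate occurs in exactly one factor.\<close>
    define \<rho> where "\<rho> = the_inv_into I \<pi>"
    have \<rho>: "\<rho> (\<pi> i) = i" "\<rho> i \<in> I" if "i \<in> I" for i
      using that \<pi> the_inv_into_f_f[of \<pi> I] the_inv_into_into[of \<pi> I i I]
      by (auto simp: \<rho>_def bij_betw_def)
    have \<rho>_bij: "bij_betw \<rho> I I"
      unfolding \<rho>_def by (rule bij_betw_the_inv_into[OF \<pi>])
    have A': "A (\<rho> j) \<in> sets (M1 \<Otimes>\<^sub>M M2)" if "j \<in> I" for j
      using A \<rho> that by blast
    let ?N = "(\<Pi>\<^sub>M i\<in>I. M1) \<Otimes>\<^sub>M (\<Pi>\<^sub>M i\<in>I. M2)"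
    have PiA: "Pi\<^sub>E I A \<in> sets (\<Pi>\<^sub>M i\<in>I. M1 \<Otimes>\<^sub>M M2)"
      using A I by (intro sets_PiM_I_finite) auto
    have "emeasure (distr ?N (\<Pi>\<^sub>M i\<in>I. M1 \<Otimes>\<^sub>M M2) ?J) (Pi\<^sub>E I A) = (\<integral>\<^sup>+ z. indicator (Pi\<^sub>E I A) (?J z) \<partial>?N)"
      using PiA J by (simp add: nn_integral_distr flip: nn_integral_indicator)
    also have "\<dots> = (\<integral>\<^sup>+ x. \<integral>\<^sup>+ y. indicator (Pi\<^sub>E I A) (?J (x, y)) \<partial>(\<Pi>\<^sub>M i\<in>I. M2) \<partial>(\<Pi>\<^sub>M i\<in>I. M1))"
      by (rule PP2.nn_integral_fst[symmetric])
         (use PiA J in \<open>auto intro!: measurable_compose[OF J] borel_measurable_indicator\<close>)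
    also have "\<dots> = (\<integral>\<^sup>+ x. (\<Prod>j\<in>I. emeasure M2 (Pair (x (\<rho> j)) -` A (\<rho> j))) \<partial>(\<Pi>\<^sub>M i\<in>I. M1))"
    proof (rule nn_integral_cong)
      fix x
      have "indicator (Pi\<^sub>E I A) (?J (x, y)) = (\<Prod>j\<in>I. indicator (Pair (x (\<rho> j)) -` A (\<rho> j)) (y j) :: ennreal)" for y
      proof -
        have "indicator (Pi\<^sub>E I A) (?J (x, y)) = (\<Prod>i\<in>I. indicator (A i) (x i, y (\<pi> i)) :: ennreal)"
          using I by (auto simp: indicator_def PiE_iff prod_zero_iff split: if_splits)
        also have "\<dots> = (\<Prod>j\<in>I. indicator (A (\<rho> j)) (x (\<rho> j), y j))"
          by (subst prod.reindex_bij_betw[OF \<pi>, symmetric]) (use \<rho> in simp)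
        finally show ?thesis
          by (simp add: indicator_def)
      qed
      then show "(\<integral>\<^sup>+ y. indicator (Pi\<^sub>E I A) (?J (x, y)) \<partial>(\<Pi>\<^sub>M i\<in>I. M2)) =
          (\<Prod>j\<in>I. emeasure M2 (Pair (x (\<rho> j)) -` A (\<rho> j)))"
        using I sets_Pair1[OF A']
        by (simp add: P2.product_nn_integral_prod[of I "\<lambda>j. indicator (Pair (x (\<rho> j)) -` A (\<rho> j))"])
    qed
    \<comment> \<open>The ordinates are integrated out, so the product can be indexed by
      \<open>i\<close> again; now each abscissa has its own factor.\<close>
    also have "\<dots> = (\<integral>\<^sup>+ x. (\<Prod>i\<in>I. emeasure M2 (Pair (x i) -` A i)) \<partial>(\<Pi>\<^sub>M i\<in>I. M1))"
      by (simp add: prod.reindex_bij_betw[OF \<rho>_bij, where g = "\<lambda>i. emeasure M2 (Pair (x i) -` A i)" for x])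
    also have "\<dots> = (\<Prod>i\<in>I. emeasure (M1 \<Otimes>\<^sub>M M2) (A i))"
      using I A by (simp add: P1.product_nn_integral_prod[of I "\<lambda>i x. emeasure M2 (Pair x -` A i)"]
        M2.emeasure_pair_measure_alt M2.measurable_emeasure_Pair)
    finally show "emeasure (distr ?N (\<Pi>\<^sub>M i\<in>I. M1 \<Otimes>\<^sub>M M2) ?J) (Pi\<^sub>E I A) = (\<Prod>i\<in>I. emeasure (M1 \<Otimes>\<^sub>M M2) (A i))" .
  qed (use I in auto)
qed

text \<open>Pairing abscissae with ordinates by the identity or by \<pi> yields the same measure.
  Pulling back the reindexed integrand along the identity pairing gives the same function as pulling
  back \<open>f\<close> along the \<pi>-pairing.\<close>

lemma integral_PiM_pair_reindex:
  fixes f :: "('i \<Rightarrow> 'a \<times> 'b) \<Rightarrow> 'c::{banach, second_countable_topology}"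
  assumes M: "sigma_finite_measure M1" "sigma_finite_measure M2"
    and I: "finite I" and \<pi>: "bij_betw \<pi> I I"
    and f: "f \<in> borel_measurable (\<Pi>\<^sub>M i\<in>I. M1 \<Otimes>\<^sub>M M2)"
  shows "(\<integral>r. f (\<lambda>i\<in>I. (fst (r i), snd (r (\<pi> i)))) \<partial>(\<Pi>\<^sub>M i\<in>I. M1 \<Otimes>\<^sub>M M2)) =
    integral\<^sup>L (\<Pi>\<^sub>M i\<in>I. M1 \<Otimes>\<^sub>M M2) f"
proof -
  let ?N = "(\<Pi>\<^sub>M i\<in>I. M1) \<Otimes>\<^sub>M (\<Pi>\<^sub>M i\<in>I. M2)" and ?P = "\<Pi>\<^sub>M i\<in>I. M1 \<Otimes>\<^sub>M M2"
  let ?J = "\<lambda>\<pi> (x, y). \<lambda>i\<in>I. (x i, y (\<pi> i))"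
  have J[measurable]: "?J \<pi> \<in> ?N \<rightarrow>\<^sub>M ?P" if "bij_betw \<pi> I I" for \<pi>
  proof -
    have mem: "\<pi> i \<in> I" if "i \<in> I" for i
      using \<open>bij_betw \<pi> I I\<close> that by (rule bij_betwE[rule_format])
    then show ?thesis
      by measurable
  qed
  have mem: "\<pi> i \<in> I" if "i \<in> I" for i
    using \<pi> that by (rule bij_betwE[rule_format])
  have id: "bij_betw id I I"
    by simp
  let ?K = "\<lambda>r. \<lambda>i\<in>I. (fst (r i), snd (r (\<pi> i)))"
  have K: "?K \<in> ?P \<rightarrow>\<^sub>M ?P"
    using mem by measurable
  have "(\<integral>r. f (?K r) \<partial>?P) = (\<integral>r. f (?K r) \<partial>distr ?N ?P (?J id))"
    by (simp only: distr_PiM_pair_reindex[OF M I id])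
  also have "\<dots> = (\<integral>z. f (?K (?J id z)) \<partial>?N)"
    by (rule integral_distr[OF J[OF id]]) (rule measurable_compose[OF K f])
  also have "\<dots> = (\<integral>z. f (?J \<pi> z) \<partial>?N)"
    using mem by (auto intro!: Bochner_Integration.integral_cong arg_cong[of _ _ f])
  also have "\<dots> = integral\<^sup>L (distr ?N ?P (?J \<pi>)) f"
    by (rule integral_distr[OF J[OF \<pi>] f, symmetric])
  finally show ?thesis
    by (simp only: distr_PiM_pair_reindex[OF M I \<pi>])
qed

text \<open>Fubini with the inserted coordinate outermost, as required to integrate the last point
  last. It comes from splitting the index set with \<open>{i}\<close> as the outer block.\<close>

lemma (in product_sigma_finite) product_integral_insert_rev:
  fixes f :: "_ \<Rightarrow> _::{banach, second_countable_topology}"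
  assumes I: "finite I" "i \<notin> I" and f: "integrable (Pi\<^sub>M (insert i I) M) f"
  shows "integral\<^sup>L (Pi\<^sub>M (insert i I) M) f = (\<integral>y. (\<integral>x. f (x(i := y)) \<partial>Pi\<^sub>M I M) \<partial>M i)"
proof -
  interpret PI: sigma_finite_measure "Pi\<^sub>M I M"
    using I(1) by (rule sigma_finite)
  have [measurable]: "f \<in> borel_measurable (Pi\<^sub>M (insert i I) M)"
    using f by auto
  have "integral\<^sup>L (Pi\<^sub>M (insert i I) M) f =
      (\<integral>y. (\<integral>x. f (merge {i} I (y, x)) \<partial>Pi\<^sub>M I M) \<partial>Pi\<^sub>M {i} M)"
    using I f by (subst product_integral_fold[symmetric]) auto
  \<comment> \<open>Points of the product over \<open>I\<close> are undefined outside
    \<open>I\<close>, so merging with a value at \<open>i\<close> is a function update.\<close>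
  also have "\<dots> = (\<integral>y. (\<integral>x. f (x(i := y i)) \<partial>Pi\<^sub>M I M) \<partial>Pi\<^sub>M {i} M)"
    using I by (intro Bochner_Integration.integral_cong refl arg_cong[of _ _ f])
      (auto simp: merge_def space_PiM PiE_def extensional_def fun_eq_iff)
  also have "\<dots> = (\<integral>y. (\<integral>x. f (x(i := y)) \<partial>Pi\<^sub>M I M) \<partial>M i)"
  proof (rule product_integral_singleton)
    show "(\<lambda>y. \<integral>x. f (x(i := y)) \<partial>Pi\<^sub>M I M) \<in> borel_measurable (M i)"
      by measurable
  qed
  finally show ?thesis .
qed

section \<open>Mixed partial derivatives of the components of the field\<close>

lemma partial2_component:
  fixes f :: "real \<times> real \<Rightarrow> real ^ 'd"
  assumes "T > 0" "C1_square T f" "x \<in> {0..T}" "y \<in> {0..T}"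
  shows "partial2 T (\<lambda>p. f p $ k) (x, y) = partial2 T f (x, y) $ k"
proof -
  have "((\<lambda>b. f (x, b)) has_vector_derivative partial2 T f (x, y)) (at y within {0..T})"
    using assms by (auto simp: C1_square_def partial2_def vector_derivative_works)
  then have "((\<lambda>b. f (x, b) $ k) has_vector_derivative partial2 T f (x, y) $ k) (at y within {0..T})"
    by (rule bounded_linear.has_vector_derivative[OF bounded_linear_vec_nth])
  then show ?thesis
    unfolding partial2_def prod.case
    by (rule vector_derivative_within_closed_interval[OF assms(1,4)])
qed

text \<open>The regularity assumption concerns the vector field, while the coefficients
  differentiate its components. Projection is bounded linear and commutes with each derivative. The
  outer derivative is taken within \<open>{0..T}\<close>, where the inner one has already been
  computed, and \<open>T > 0\<close> makes one-sided derivatives unique.\<close>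

lemma partial12_component:
  fixes f :: "real \<times> real \<Rightarrow> real ^ 'd"
  assumes T: "T > 0" and f: "C2_square T f" and xy: "x \<in> {0..T}" "y \<in> {0..T}"
  shows "partial12 T (\<lambda>p. f p $ k) (x, y) = partial12 T f (x, y) $ k"
proof -
  have "((\<lambda>a. partial2 T f (a, y)) has_vector_derivative partial12 T f (x, y)) (at x within {0..T})"
    using f xy by (auto simp: C2_square_def C1_square_def[of T "partial2 T f"]
      partial12_def partial1_def vector_derivative_works)
  then have "((\<lambda>a. partial2 T f (a, y) $ k) has_vector_derivative partial12 T f (x, y) $ k)
      (at x within {0..T})"
    by (rule bounded_linear.has_vector_derivative[OF bounded_linear_vec_nth])
  then have "((\<lambda>a. partial2 T (\<lambda>p. f p $ k) (a, y)) has_vector_derivative partial12 T f (x, y) $ k)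
      (at x within {0..T})"
    by (rule has_vector_derivative_transform[rotated 2])
       (use T f xy in \<open>auto simp: partial2_component C2_square_def\<close>)
  then show ?thesis
    unfolding partial12_def[of T "\<lambda>p. f p $ k"] partial1_def prod.case
    by (rule vector_derivative_within_closed_interval[OF T xy(1)])
qed

lemma continuous_on_partial12_component:
  fixes f :: "real \<times> real \<Rightarrow> real ^ 'd"
  assumes "T > 0" "C2_square T f"
  shows "continuous_on ({0..T} \<times> {0..T}) (partial12 T (\<lambda>p. f p $ k))"
proof -
  have "continuous_on ({0..T} \<times> {0..T}) (\<lambda>p. partial12 T f p $ k)"
    using assms by (intro continuous_on_component) (auto simp: C2_square_def C1_square_def partial12_def)
  then show ?thesis
    by (rule continuous_on_eq) (use assms in \<open>auto simp: partial12_component\<close>)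
qed

section \<open>Truncated densities and regions of ordered points\<close>

text \<open>Cutting off outside the square gives a density integrable over the whole plane, so
  Fubini can be applied on all of it. Rectangles with corners in the square do not see the
  truncation.\<close>

definition mixed_density :: "real \<Rightarrow> (real \<times> real \<Rightarrow> real ^ 'd) \<Rightarrow> 'd \<Rightarrow> real \<times> real \<Rightarrow> real" where
  "mixed_density T X k p = indicator ({0..T} \<times> {0..T}) p * partial12 T (\<lambda>p. X p $ k) p"

lemma integrable_mixed_density:
  assumes "T > 0" "C2_square T X"
  shows "integrable lborel (mixed_density T X k)"
  using borel_integrable_compact[OF _ continuous_on_partial12_component[OF assms]]
  by (simp add: mixed_density_def[abs_def] compact_Times)

text \<open>The image of \<^const>\<open>simplex2\<close> under \<open>r \<mapsto> (r\<^sub>1\<^sup>i, r\<^sub>2\<^sup>\<nu>\<^sup>(\<^sup>i\<^sup>))\<^sub>i\<close>, without the extensionality condition.\<close>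

definition ordered_points ::
    "nat \<Rightarrow> nat list \<Rightarrow> real \<times> real \<Rightarrow> real \<times> real \<Rightarrow> (nat \<Rightarrow> real \<times> real) set" where
  "ordered_points n \<nu> s t =
     {p. (\<forall>i\<in>{1..n}. fst s \<le> fst (p i) \<and> fst (p i) \<le> fst t \<and>
                     snd s \<le> snd (p i) \<and> snd (p i) \<le> snd t) \<and>
         (\<forall>i\<in>{1..n}. \<forall>j\<in>{1..n}. (i \<le> j \<longrightarrow> fst (p i) \<le> fst (p j)) \<and>
            (\<nu> ! (i - 1) \<le> \<nu> ! (j - 1) \<longrightarrow> snd (p i) \<le> snd (p j)))}"

lemma measurable_ordered_points:
  "Measurable.pred (\<Pi>\<^sub>M i\<in>{1..n}. lborel) (\<lambda>p. p \<in> ordered_points n \<nu> s t)"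
proof -
  let ?P = "\<Pi>\<^sub>M i\<in>{1..n}. (lborel :: (real \<times> real) measure)"
  have coord: "(\<lambda>p. fst (p i)) \<in> borel_measurable ?P" "(\<lambda>p. snd (p i)) \<in> borel_measurable ?P"
    if "i \<in> {1..n}" for i
    by (rule measurable_compose[OF measurable_component_singleton[OF that]],
        simp add: borel_measurable_continuous_onI continuous_on_fst continuous_on_snd)+
  have le: "Measurable.pred ?P (\<lambda>p. f p \<le> g p)"
    if "f \<in> borel_measurable ?P" "g \<in> borel_measurable ?P" for f g :: "_ \<Rightarrow> real"
    unfolding pred_def by (rule borel_measurable_le[OF that])
  show ?thesis
    unfolding ordered_points_def mem_Collect_eq
    by (intro pred_intros_countable_bounded(3) pred_intros_logic(3) pred_intros_imp' le
        borel_measurable_const coord)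
qed

definition point_weight ::
    "real \<Rightarrow> (real \<times> real \<Rightarrow> real ^ 'd) \<Rightarrow> 'd list \<Rightarrow> nat \<Rightarrow> (nat \<Rightarrow> real \<times> real) \<Rightarrow> real" where
  "point_weight T X w n p = (\<Prod>i\<in>{1..n}. mixed_density T X (w ! (i - 1)) (p i))"

lemma borel_measurable_point_weight:
  assumes "T > 0" "C2_square T X"
  shows "point_weight T X w n \<in> borel_measurable (\<Pi>\<^sub>M i\<in>{1..n}. lborel)"
proof -
  have "mixed_density T X k \<in> borel_measurable lborel" for k
    using integrable_mixed_density[OF assms] by (rule borel_measurable_integrable)
  then show ?thesis
    unfolding point_weight_def[abs_def]
    by (intro borel_measurable_prod measurable_compose[OF measurable_component_singleton])
qed

text \<open>The weight separates the variables, so it is integrable because each density is;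
  restricting to a measurable region keeps it dominated. This justifies both Fubini and the termwise
  integration of differences of regions.\<close>

lemma integrable_point_weight:
  assumes "T > 0" "C2_square T X"
  shows "integrable (\<Pi>\<^sub>M i\<in>{1..n}. lborel)
    (\<lambda>p. indicator (ordered_points n \<nu> s t) p * point_weight T X w n p)"
proof -
  interpret product_sigma_finite "\<lambda>_::nat. lborel :: (real \<times> real) measure"
    by (simp add: product_sigma_finite_def lborel.sigma_finite_measure_axioms)
  let ?P = "\<Pi>\<^sub>M i\<in>{1..n}. (lborel :: (real \<times> real) measure)"
  have int: "integrable ?P (point_weight T X w n)"
    unfolding point_weight_def[abs_def]
    by (rule product_integrable_prod) (use assms in \<open>auto intro: integrable_mixed_density\<close>)
  have "integrable ?P (\<lambda>p. if p \<in> ordered_points n \<nu> s t then point_weight T X w n p else 0)"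
    using measurable_ordered_points[of n \<nu> s t] int
    by (intro Bochner_Integration.integrable_bound[OF int] measurable_If) auto
  also have "(\<lambda>p. if p \<in> ordered_points n \<nu> s t then point_weight T X w n p else 0) =
      (\<lambda>p. indicator (ordered_points n \<nu> s t) p * point_weight T X w n p)"
    by (auto simp: fun_eq_iff)
  finally show ?thesis .
qed

section \<open>Coefficients as integrals over ordered points\<close>

lemma bij_betw_nth_permutation:
  assumes "\<nu> \<in> permutations_of_set {1..n}"
  shows "bij_betw (\<lambda>i. \<nu> ! (i - 1)) {1..n} {1..n}"
proof -
  have "length \<nu> = n" "distinct \<nu>" "set \<nu> = {1..n}"
    using assms length_finite_permutations_of_set[OF assms] by (auto simp: permutations_of_set_def)
  then have "bij_betw ((!) \<nu>) {..<n} {1..n}"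
    by (intro bij_betw_nth) auto
  moreover have "bij_betw (\<lambda>i. i - 1) {1..n} {..<n}"
    by (rule bij_betw_byWitness[where f' = Suc]) auto
  ultimately have "bij_betw ((!) \<nu> \<circ> (\<lambda>i. i - 1)) {1..n} {1..n}"
    by (intro bij_betw_trans)
  then show ?thesis
    by (simp add: o_def)
qed

text \<open>The conditions on ordinates are quantified over all of \<open>{1..n}\<close>, so
  substituting the bijection \<pi> does not change them. Hence \<open>r\<close> lies in the simplex
  exactly when the reindexed point lies in \<open>ordered_points\<close>, and the invariance of the
  integral under reindexing applies.\<close>

lemma sig2_eq_integral_ordered_points:
  assumes X: "T > 0" "C2_square T X"
    and st: "s \<in> {0..T} \<times> {0..T}" "t \<in> {0..T} \<times> {0..T}"
    and w: "length w = n" "w \<noteq> []" and \<nu>: "\<nu> \<in> permutations_of_set {1..n}"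
  shows "sig2 T X s t w \<nu> =
    (LINT p | (\<Pi>\<^sub>M i\<in>{1..n}. lborel). indicator (ordered_points n \<nu> s t) p * point_weight T X w n p)"
proof -
  let ?P = "\<Pi>\<^sub>M i\<in>{1..n}. (lborel :: (real \<times> real) measure)"
  define \<pi> where "\<pi> i = \<nu> ! (i - 1)" for i
  have \<pi>: "bij_betw \<pi> {1..n} {1..n}"
    using bij_betw_nth_permutation[OF \<nu>] by (simp add: \<pi>_def[abs_def])
  have \<pi>_all: "(\<forall>i\<in>{1..n}. Q (\<pi> i)) \<longleftrightarrow> (\<forall>i\<in>{1..n}. Q i)" for Q
    using bij_betw_imp_surj_on[OF \<pi>] by (metis (no_types, lifting) image_iff)
  have mem: "\<pi> i \<in> {1..n}" if "i \<in> {1..n}" for i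
    using \<pi> that by (rule bij_betwE[rule_format])
  define f where "f p = indicator (ordered_points n \<nu> s t) p * point_weight T X w n p" for p
  have "sig2 T X s t w \<nu> = (LINT r : simplex2 n s t | ?P.
      (\<Prod>i\<in>{1..n}. partial12 T (\<lambda>p. X p $ (w ! (i - 1))) (fst (r i), snd (r (\<pi> i)))))"
    using w by (simp add: sig2_def \<pi>_def)
  also have "\<dots> = (LINT r | ?P. f (\<lambda>i\<in>{1..n}. (fst (r i), snd (r (\<pi> i)))))"
    unfolding set_lebesgue_integral_def
  proof (rule Bochner_Integration.integral_cong[OF refl])
    fix r :: "nat \<Rightarrow> real \<times> real" assume r: "r \<in> space ?P"
    let ?q = "\<lambda>i\<in>{1..n}. (fst (r i), snd (r (\<pi> i)))"
    have box: "(\<forall>i\<in>{1..n}. snd s \<le> snd (r (\<pi> i))) \<longleftrightarrow> (\<forall>i\<in>{1..n}. snd s \<le> snd (r i))"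
      "(\<forall>i\<in>{1..n}. snd (r (\<pi> i)) \<le> snd t) \<longleftrightarrow> (\<forall>i\<in>{1..n}. snd (r i) \<le> snd t)"
      by (rule \<pi>_all[of "\<lambda>a. snd s \<le> snd (r a)"], rule \<pi>_all[of "\<lambda>a. snd (r a) \<le> snd t"])
    \<comment> \<open>The two quantifiers are reindexed one after the other, first \<open>i\<close>,
      then \<open>j\<close>.\<close>
    have "(\<forall>i\<in>{1..n}. \<forall>j\<in>{1..n}. \<pi> i \<le> \<pi> j \<longrightarrow> snd (r (\<pi> i)) \<le> snd (r (\<pi> j))) \<longleftrightarrow>
        (\<forall>i\<in>{1..n}. \<forall>j\<in>{1..n}. i \<le> \<pi> j \<longrightarrow> snd (r i) \<le> snd (r (\<pi> j)))"
      by (rule \<pi>_all[of "\<lambda>a. \<forall>j\<in>{1..n}. a \<le> \<pi> j \<longrightarrow> snd (r a) \<le> snd (r (\<pi> j))"])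
    also have "\<dots> \<longleftrightarrow> (\<forall>i\<in>{1..n}. \<forall>j\<in>{1..n}. i \<le> j \<longrightarrow> snd (r i) \<le> snd (r j))"
      by (intro ball_cong refl \<pi>_all[of "\<lambda>a. i \<le> a \<longrightarrow> snd (r i) \<le> snd (r a)" for i])
    finally have mono: "(\<forall>i\<in>{1..n}. \<forall>j\<in>{1..n}. \<pi> i \<le> \<pi> j \<longrightarrow> snd (r (\<pi> i)) \<le> snd (r (\<pi> j))) \<longleftrightarrow>
        (\<forall>i\<in>{1..n}. \<forall>j\<in>{1..n}. i \<le> j \<longrightarrow> snd (r i) \<le> snd (r j))" .
    have "?q \<in> ordered_points n \<nu> s t \<longleftrightarrow>
        (\<forall>i\<in>{1..n}. fst s \<le> fst (r i) \<and> fst (r i) \<le> fst t \<and>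
          snd s \<le> snd (r (\<pi> i)) \<and> snd (r (\<pi> i)) \<le> snd t) \<and>
        (\<forall>i\<in>{1..n}. \<forall>j\<in>{1..n}. (i \<le> j \<longrightarrow> fst (r i) \<le> fst (r j)) \<and>
          (\<pi> i \<le> \<pi> j \<longrightarrow> snd (r (\<pi> i)) \<le> snd (r (\<pi> j))))"
      by (simp add: ordered_points_def \<pi>_def restrict_apply'
          del: restrict_apply atLeastAtMost_iff One_nat_def cong: ball_cong)
    moreover have "r \<in> simplex2 n s t \<longleftrightarrow>
        (\<forall>i\<in>{1..n}. fst s \<le> fst (r i) \<and> fst (r i) \<le> fst t \<and> snd s \<le> snd (r i) \<and> snd (r i) \<le> snd t) \<and>
        (\<forall>i\<in>{1..n}. \<forall>j\<in>{1..n}. (i \<le> j \<longrightarrow> fst (r i) \<le> fst (r j)) \<and>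
          (i \<le> j \<longrightarrow> snd (r i) \<le> snd (r j)))"
    proof -
      have "r \<in> {1..n} \<rightarrow>\<^sub>E UNIV"
        using r by (simp add: space_PiM)
      then show ?thesis
        by (simp only: simplex2_def mem_Collect_eq simp_thms imp_conjR)
    qed
    ultimately have iff: "r \<in> simplex2 n s t \<longleftrightarrow> ?q \<in> ordered_points n \<nu> s t"
      by (simp only: ball_conj_distrib box mono)
    show "indicator (simplex2 n s t) r *\<^sub>R
        (\<Prod>i\<in>{1..n}. partial12 T (\<lambda>p. X p $ (w ! (i - 1))) (fst (r i), snd (r (\<pi> i)))) = f ?q"
    proof (cases "r \<in> simplex2 n s t")
      case True
      then have r_box: "fst s \<le> fst (r i) \<and> fst (r i) \<le> fst t \<and> snd s \<le> snd (r i) \<and> snd (r i) \<le> snd t"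
        if "i \<in> {1..n}" for i
        using that unfolding simplex2_def by blast
      \<comment> \<open>The two coordinates come from different points of \<open>r\<close>, but both
        satisfy the bounds of the rectangle, so the truncation factor is 1.\<close>
      have "(fst (r i), snd (r (\<pi> i))) \<in> {0..T} \<times> {0..T}" if "i \<in> {1..n}" for i
        using r_box[OF that] r_box[OF mem[OF that]] st by (auto simp: mem_Times_iff)
      then have "point_weight T X w n ?q =
          (\<Prod>i\<in>{1..n}. partial12 T (\<lambda>p. X p $ (w ! (i - 1))) (fst (r i), snd (r (\<pi> i))))"
        unfolding point_weight_def mixed_density_def by (intro prod.cong refl) simp
      moreover have "?q \<in> ordered_points n \<nu> s t"
        using True iff by blast
      ultimately show ?thesis
        using True unfolding f_def by simp
    next
      case False
      then have "?q \<notin> ordered_points n \<nu> s t"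
        using iff by blast
      with False show ?thesis
        unfolding f_def by simp
    qed
  qed
  also have "\<dots> = integral\<^sup>L ?P f"
  proof -
    have "f \<in> borel_measurable ?P"
      using integrable_point_weight[OF X] by (auto simp: f_def[abs_def])
    then show ?thesis
      by (intro integral_PiM_pair_reindex[of lborel lborel, unfolded lborel_prod] \<pi>
          lborel.sigma_finite_measure_axioms finite_atLeastAtMost)
  qed
  finally show ?thesis
    unfolding f_def .
qed

text \<open>The factor at the last point depends only on \<open>v\<close> and leaves the inner
  integral. What remains there is the section of the region at \<open>v\<close>, weighted by the
  shortened word.\<close>

lemma sig2_eq_integral_last_point:
  assumes X: "T > 0" "C2_square T X"
    and st: "s \<in> {0..T} \<times> {0..T}" "t \<in> {0..T} \<times> {0..T}"
    and w: "length w = Suc n" and \<nu>: "\<nu> \<in> permutations_of_set {1..Suc n}"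
  shows "sig2 T X s t w \<nu> =
    (LINT v | lborel. (LINT p | (\<Pi>\<^sub>M i\<in>{1..n}. lborel).
        indicator (ordered_points (Suc n) \<nu> s t) (p(Suc n := v)) * point_weight T X (butlast w) n p)
      * mixed_density T X (last w) v)"
proof -
  interpret product_sigma_finite "\<lambda>_::nat. lborel :: (real \<times> real) measure"
    by (simp add: product_sigma_finite_def lborel.sigma_finite_measure_axioms)
  \<comment> \<open>Lists are indexed from 0, so the letter of point \<open>Suc n\<close> is
    \<open>w ! n\<close>.\<close>
  have last: "w ! n = last w"
    using w by (metis diff_Suc_1 last_conv_nth list.size(3) nat.distinct(1))
  have weight: "point_weight T X w (Suc n) (p(Suc n := v)) =
      point_weight T X (butlast w) n p * mixed_density T X (last w) v" for p v
    using w by (auto simp: point_weight_def atLeastAtMostSuc_conv last nth_butlast mult.commute intro!: prod.cong)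
  show ?thesis
    using w \<nu> integrable_point_weight[OF X, of "Suc n" \<nu> s t w]
    by (subst sig2_eq_integral_ordered_points[OF X st w])
       (auto simp: atLeastAtMostSuc_conv product_integral_insert_rev weight mult.assoc
         simp flip: integral_mult_left_zero)
qed

section \<open>Sections of the region at the last point\<close>

text \<open>Comparison with the last index places every other point to the left of and below
  \<open>v\<close>. As \<open>v\<close> lies in the rectangle, these bounds imply those by
  \<open>t\<close>, so \<open>v\<close> becomes the new upper corner. Among the first
  \<open>n\<close> points only the relative order of the values of \<nu> matters, and
  \<open>\<nu>'\<close> records it.\<close>

lemma ordered_points_last_max:
  assumes "\<And>i j. i \<in> {1..n} \<Longrightarrow> j \<in> {1..n} \<Longrightarrow> \<nu> ! (i - 1) \<le> \<nu> ! (j - 1) \<longleftrightarrow> \<nu>' ! (i - 1) \<le> \<nu>' ! (j - 1)"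
    and "\<And>i. i \<in> {1..n} \<Longrightarrow> \<nu> ! (i - 1) < \<nu> ! n"
    and "v \<in> {fst s..fst t} \<times> {snd s..snd t}"
  shows "p(Suc n := v) \<in> ordered_points (Suc n) \<nu> s t \<longleftrightarrow> p \<in> ordered_points n \<nu>' s v"
proof -
  define I where "I = {1..n}"
  define a b where "a i = \<nu> ! (i - 1)" and "b i = \<nu>' ! (i - 1)" for i
  have ball: "(\<forall>i\<in>{1..Suc n}. P i) \<longleftrightarrow> (\<forall>i\<in>I. P i) \<and> P (Suc n)" for P
    by (auto simp: I_def atLeastAtMostSuc_conv)
  have ab: "a i \<le> a j \<longleftrightarrow> b i \<le> b j" if "i \<in> I" "j \<in> I" for i j
    using assms(1) that by (simp add: I_def a_def b_def)
  \<comment> \<open>All comparisons with the last index are decided here, leaving ordering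
    conditions only between pairs in \<open>I\<close>.\<close>
  have I: "i \<noteq> Suc n" "i \<le> Suc n" "\<not> Suc n \<le> i" "a i \<le> a (Suc n)" "\<not> a (Suc n) \<le> a i"
    if "i \<in> I" for i
    using assms(2)[of i] that by (auto simp: I_def a_def)
  have v: "fst s \<le> fst v" "fst v \<le> fst t" "snd s \<le> snd v" "snd v \<le> snd t"
    using assms(3) by (auto simp: mem_Times_iff)
  have "p(Suc n := v) \<in> ordered_points (Suc n) \<nu> s t \<longleftrightarrow>
      ((\<forall>i\<in>I. fst s \<le> fst (p i) \<and> fst (p i) \<le> fst t \<and> snd s \<le> snd (p i) \<and> snd (p i) \<le> snd t) \<and>
      (\<forall>i\<in>I. fst (p i) \<le> fst v \<and> snd (p i) \<le> snd v)) \<and>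
      (\<forall>i\<in>I. \<forall>j\<in>I. (i \<le> j \<longrightarrow> fst (p i) \<le> fst (p j)) \<and> (b i \<le> b j \<longrightarrow> snd (p i) \<le> snd (p j)))"
    unfolding ordered_points_def mem_Collect_eq ball a_def[symmetric]
    using v by (simp add: ab I ball_conj_distrib cong: ball_cong) blast
  also have "\<dots> \<longleftrightarrow>
      (\<forall>i\<in>I. fst s \<le> fst (p i) \<and> fst (p i) \<le> fst v \<and> snd s \<le> snd (p i) \<and> snd (p i) \<le> snd v) \<and>
      (\<forall>i\<in>I. \<forall>j\<in>I. (i \<le> j \<longrightarrow> fst (p i) \<le> fst (p j)) \<and> (b i \<le> b j \<longrightarrow> snd (p i) \<le> snd (p j)))"
    by (rule arg_cong2[of _ _ _ _ "(\<and>)"]) (use v in \<open>auto intro: order_trans\<close>)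
  also have "\<dots> \<longleftrightarrow> p \<in> ordered_points n \<nu>' s v"
    by (simp add: ordered_points_def I_def b_def)
  finally show ?thesis .
qed

text \<open>The same reduction with ordinates reversed: the ordinate of \<open>v\<close> replaces
  the lower bound, while abscissae are still cut off above by that of \<open>v\<close>.\<close>

lemma ordered_points_last_min:
  assumes "\<And>i j. i \<in> {1..n} \<Longrightarrow> j \<in> {1..n} \<Longrightarrow> \<nu> ! (i - 1) \<le> \<nu> ! (j - 1) \<longleftrightarrow> \<nu>' ! (i - 1) \<le> \<nu>' ! (j - 1)"
    and "\<And>i. i \<in> {1..n} \<Longrightarrow> \<nu> ! n < \<nu> ! (i - 1)"
    and "v \<in> {fst s..fst t} \<times> {snd s..snd t}"
  shows "p(Suc n := v) \<in> ordered_points (Suc n) \<nu> s t \<longleftrightarrow>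
    p \<in> ordered_points n \<nu>' (fst s, snd v) (fst v, snd t)"
proof -
  define I where "I = {1..n}"
  define a b where "a i = \<nu> ! (i - 1)" and "b i = \<nu>' ! (i - 1)" for i
  have ball: "(\<forall>i\<in>{1..Suc n}. P i) \<longleftrightarrow> (\<forall>i\<in>I. P i) \<and> P (Suc n)" for P
    by (auto simp: I_def atLeastAtMostSuc_conv)
  have ab: "a i \<le> a j \<longleftrightarrow> b i \<le> b j" if "i \<in> I" "j \<in> I" for i j
    using assms(1) that by (simp add: I_def a_def b_def)
  have I: "i \<noteq> Suc n" "i \<le> Suc n" "\<not> Suc n \<le> i" "a (Suc n) \<le> a i" "\<not> a i \<le> a (Suc n)"
    if "i \<in> I" for i
    using assms(2)[of i] that by (auto simp: I_def a_def)
  have v: "fst s \<le> fst v" "fst v \<le> fst t" "snd s \<le> snd v" "snd v \<le> snd t"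
    using assms(3) by (auto simp: mem_Times_iff)
  have "p(Suc n := v) \<in> ordered_points (Suc n) \<nu> s t \<longleftrightarrow>
      ((\<forall>i\<in>I. fst s \<le> fst (p i) \<and> fst (p i) \<le> fst t \<and> snd s \<le> snd (p i) \<and> snd (p i) \<le> snd t) \<and>
      (\<forall>i\<in>I. fst (p i) \<le> fst v \<and> snd v \<le> snd (p i))) \<and>
      (\<forall>i\<in>I. \<forall>j\<in>I. (i \<le> j \<longrightarrow> fst (p i) \<le> fst (p j)) \<and> (b i \<le> b j \<longrightarrow> snd (p i) \<le> snd (p j)))"
    unfolding ordered_points_def mem_Collect_eq ball a_def[symmetric]
    using v by (simp add: ab I ball_conj_distrib cong: ball_cong) blast
  also have "\<dots> \<longleftrightarrow>
      (\<forall>i\<in>I. fst s \<le> fst (p i) \<and> fst (p i) \<le> fst v \<and> snd v \<le> snd (p i) \<and> snd (p i) \<le> snd t) \<and>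
      (\<forall>i\<in>I. \<forall>j\<in>I. (i \<le> j \<longrightarrow> fst (p i) \<le> fst (p j)) \<and> (b i \<le> b j \<longrightarrow> snd (p i) \<le> snd (p j)))"
    by (rule arg_cong2[of _ _ _ _ "(\<and>)"]) (use v in \<open>auto intro: order_trans\<close>)
  also have "\<dots> \<longleftrightarrow> p \<in> ordered_points n \<nu>' (fst s, snd v) (fst v, snd t)"
    by (simp add: ordered_points_def I_def b_def)
  finally show ?thesis .
qed

text \<open>The exceptional set is a box with a horizontal line as its factor at \<open>i\<close>.
  The line is null in the plane, and in \<open>ennreal\<close> the zero factor prevails over the
  infinite measures of the other factors.\<close>

lemma AE_PiM_lborel_snd_neq:
  assumes "finite I" "i \<in> I"
  shows "AE p in (\<Pi>\<^sub>M i\<in>I. lborel :: (real \<times> real) measure). snd (p i) \<noteq> c"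
proof -
  interpret product_sigma_finite "\<lambda>_. lborel :: (real \<times> real) measure"
    by (simp add: product_sigma_finite_def lborel.sigma_finite_measure_axioms)
  let ?P = "\<Pi>\<^sub>M i\<in>I. (lborel :: (real \<times> real) measure)"
  define A where "A j = (if j = i then UNIV \<times> {c} else UNIV :: (real \<times> real) set)" for j
  have A: "A j \<in> sets lborel" for j
    by (auto simp: A_def borel_Times)
  have "emeasure (lborel :: (real \<times> real) measure) (UNIV \<times> {c}) = 0"
    by (simp add: lborel.emeasure_pair_measure_Times flip: lborel_prod)
  then have "emeasure (lborel :: (real \<times> real) measure) (A i) = 0"
    by (simp add: A_def)
  then have "emeasure ?P (Pi\<^sub>E I A) = 0"
    using assms A by (subst emeasure_PiM) (auto simp: prod_zero_iff)
  then show ?thesis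
    using assms A by (intro AE_I[where N = "Pi\<^sub>E I A"])
      (auto simp: space_PiM A_def mem_Times_iff intro!: sets_PiM_I_finite)
qed

text \<open>The section consists of the pairs whose ordinates \<open>y\<close>, \<open>y'\<close>, listed in the order prescribed by
  \<open>\<nu>'\<close>, satisfy \<open>y \<le> v2 \<le> y'\<close>; among all pairs with \<open>y \<le> y'\<close> it excludes those on one side of \<open>v2\<close>.\<close>

lemma ordered_points_last_middle:
  assumes "(\<nu>, \<nu>') \<in> {([1,3,2], [1,2]), ([3,1,2], [2,1])}"
    and "(v1, v2) \<in> {s1..t1} \<times> {s2..t2}"
    and "snd (p 1) \<noteq> v2" "snd (p 2) \<noteq> v2"
  shows "indicator (ordered_points 3 \<nu> (s1, s2) (t1, t2)) (p(3 := (v1, v2))) =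
    (indicator (ordered_points 2 \<nu>' (s1, s2) (v1, t2)) p
      - indicator (ordered_points 2 \<nu>' (s1, s2) (v1, v2)) p
      - indicator (ordered_points 2 \<nu>' (s1, v2) (v1, t2)) p :: real)"
proof -
  have ball2: "(\<forall>i\<in>{1..2::nat}. P i) \<longleftrightarrow> P 1 \<and> P 2" for P
    by (auto simp: numeral_2_eq_2 atLeastAtMostSuc_conv)
  have ball3: "(\<forall>i\<in>{1..3::nat}. P i) \<longleftrightarrow> P 1 \<and> P 2 \<and> P 3" for P
    by (auto simp: numeral_3_eq_3 numeral_2_eq_2 atLeastAtMostSuc_conv)
  let ?A = "ordered_points 2 \<nu>' (s1, s2) (v1, t2)"
    and ?B = "ordered_points 2 \<nu>' (s1, s2) (v1, v2)"
    and ?C = "ordered_points 2 \<nu>' (s1, v2) (v1, t2)"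
  obtain x1 y1 x2 y2 where p: "p 1 = (x1, y1)" "p 2 = (x2, y2)"
    by (metis surj_pair)
  have v: "s1 \<le> v1" "v1 \<le> t1" "s2 \<le> v2" "v2 \<le> t2" and y: "y1 \<noteq> v2" "y2 \<noteq> v2"
    using assms(2-4) p by auto
  consider (a) "\<nu> = [1,3,2]" "\<nu>' = [1,2]" | (b) "\<nu> = [3,1,2]" "\<nu>' = [2,1]"
    using assms(1) by auto
  \<comment> \<open>\<open>?B\<close> and \<open>?C\<close> can only meet where both ordinates equal
    \<open>v2\<close>. With that value excluded they are disjoint subsets of \<open>?A\<close>, so
    subtracting indicators amounts to removing sets.\<close>
  then have "p \<in> ?B \<longrightarrow> p \<in> ?A" "p \<in> ?C \<longrightarrow> p \<in> ?A" "\<not> (p \<in> ?B \<and> p \<in> ?C)"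
    and "p(3 := (v1, v2)) \<in> ordered_points 3 \<nu> (s1, s2) (t1, t2) \<longleftrightarrow> p \<in> ?A \<and> p \<notin> ?B \<and> p \<notin> ?C"
    using v y
    by (cases; simp add: ordered_points_def ball2 ball3 p del: One_nat_def; linarith)+
  then show ?thesis
    by (auto simp: indicator_def)
qed

section \<open>Evaluation of the kernels\<close>

text \<open>The last value of \<nu> selects the formula: if it is the largest or smallest, the
  section is one region, and otherwise, which happens only for three points, a difference of three.
  In each case \<open>\<nu>'\<close> is the pattern formed by the remaining values.\<close>

lemma integral_last_section_eq_sig_kernel:
  assumes X: "T > 0" "C2_square T X"
    and st: "s1 \<in> {0..T}" "s2 \<in> {0..T}" "t1 \<in> {0..T}" "t2 \<in> {0..T}"
    and u: "length u = n" "n \<le> 2" and \<nu>: "\<nu> \<in> permutations_of_set {1..Suc n}"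
    and v: "(v1, v2) \<in> {s1..t1} \<times> {s2..t2}"
  shows "(LINT p | (\<Pi>\<^sub>M i\<in>{1..n}. lborel).
      indicator (ordered_points (Suc n) \<nu> (s1, s2) (t1, t2)) (p(Suc n := (v1, v2))) * point_weight T X u n p)
    = sig_kernel T X (s1, s2) (t1, t2) u \<nu> (v1, v2)" (is "?L = _")
proof -
  let ?P = "\<lambda>n. \<Pi>\<^sub>M i\<in>{1..n::nat}. (lborel :: (real \<times> real) measure)"
  have sig: "(LINT p | ?P n. indicator (ordered_points n \<nu>' (a, b) (c, d)) p * point_weight T X u n p) =
      sig2 T X (a, b) (c, d) u \<nu>'"
    if "u \<noteq> []" "\<nu>' \<in> permutations_of_set {1..n}" "{a, b, c, d} \<subseteq> {0..T}" for \<nu>' a b c d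
    using sig2_eq_integral_ordered_points[OF X, of "(a, b)" "(c, d)" u n \<nu>'] u that by auto
  have sq: "v1 \<in> {0..T}" "v2 \<in> {0..T}"
    using st v by auto
  have max: "?L = sig2 T X (s1, s2) (v1, v2) u \<nu>'"
    if "u \<noteq> []" "\<nu>' \<in> permutations_of_set {1..n}"
      "\<And>i j. i \<in> {1..n} \<Longrightarrow> j \<in> {1..n} \<Longrightarrow> \<nu> ! (i - 1) \<le> \<nu> ! (j - 1) \<longleftrightarrow> \<nu>' ! (i - 1) \<le> \<nu>' ! (j - 1)"
      "\<And>i. i \<in> {1..n} \<Longrightarrow> \<nu> ! (i - 1) < \<nu> ! n" for \<nu>'
    using ordered_points_last_max[OF that(3,4), of "(v1, v2)" "(s1, s2)" "(t1, t2)"]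
      sig[OF that(1,2), of s1 s2 v1 v2] st sq v by (simp add: indicator_def)
  have min: "?L = sig2 T X (s1, v2) (v1, t2) u \<nu>'"
    if "u \<noteq> []" "\<nu>' \<in> permutations_of_set {1..n}"
      "\<And>i j. i \<in> {1..n} \<Longrightarrow> j \<in> {1..n} \<Longrightarrow> \<nu> ! (i - 1) \<le> \<nu> ! (j - 1) \<longleftrightarrow> \<nu>' ! (i - 1) \<le> \<nu>' ! (j - 1)"
      "\<And>i. i \<in> {1..n} \<Longrightarrow> \<nu> ! n < \<nu> ! (i - 1)" for \<nu>'
    using ordered_points_last_min[OF that(3,4), of "(v1, v2)" "(s1, s2)" "(t1, t2)"]
      sig[OF that(1,2), of s1 v2 v1 t2] st sq v by (simp add: indicator_def)
  have middle: "?L = sig2 T X (s1, s2) (v1, t2) u \<nu>' - sig2 T X (s1, s2) (v1, v2) u \<nu>'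
      - sig2 T X (s1, v2) (v1, t2) u \<nu>'"
    if n: "n = 2" and \<nu>\<nu>': "(\<nu>, \<nu>') \<in> {([1,3,2], [1,2]), ([3,1,2], [2,1])}" for \<nu>'
  proof -
    have perm: "\<nu>' \<in> permutations_of_set {1..n}"
      using \<nu>\<nu>' n by (auto simp: permutations_of_set_def)
    have ne: "u \<noteq> []"
      using u n by auto
    let ?W = "\<lambda>s t p. indicator (ordered_points n \<nu>' s t) p * point_weight T X u n p"
    have int: "integrable (?P n) (?W s t)" for s t
      by (rule integrable_point_weight[OF X])
    \<comment> \<open>Passing from equality almost everywhere to equality of integrals requires
      measurability. The section is the preimage of a measurable region under adjoining the fixed
      last point.\<close>
    have upd: "(\<lambda>p. p(Suc n := (v1, v2))) \<in> ?P n \<rightarrow>\<^sub>M ?P (Suc n)"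
      by (rule measurable_fun_upd[where J = "{1..n}"]) auto
    have section_measurable: "(\<lambda>p. indicator (ordered_points (Suc n) \<nu> (s1, s2) (t1, t2)) (p(Suc n := (v1, v2)))
        * point_weight T X u n p) \<in> borel_measurable (?P n)"
      using measurable_compose[OF upd measurable_ordered_points]
      by (intro borel_measurable_times borel_measurable_indicator' borel_measurable_point_weight[OF X])
         (simp add: pred_def)
    have "AE p in ?P n. indicator (ordered_points (Suc n) \<nu> (s1, s2) (t1, t2)) (p(Suc n := (v1, v2)))
          * point_weight T X u n p =
        ?W (s1, s2) (v1, t2) p - ?W (s1, s2) (v1, v2) p - ?W (s1, v2) (v1, t2) p"
    proof -
      have "AE p in ?P n. snd (p 1) \<noteq> v2" "AE p in ?P n. snd (p 2) \<noteq> v2"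
        using n by (auto intro!: AE_PiM_lborel_snd_neq)
      then show ?thesis
      proof eventually_elim
        case (elim p)
        then show ?case
          using n by (simp add: ordered_points_last_middle[OF \<nu>\<nu>' v elim] left_diff_distrib)
      qed
    qed
    then have "?L = (LINT p | ?P n. ?W (s1, s2) (v1, t2) p - ?W (s1, s2) (v1, v2) p - ?W (s1, v2) (v1, t2) p)"
      by (rule integral_cong_AE[rotated 2])
         (use int section_measurable in \<open>auto intro: borel_measurable_integrable\<close>)
    also have "\<dots> = (LINT p | ?P n. ?W (s1, s2) (v1, t2) p) - (LINT p | ?P n. ?W (s1, s2) (v1, v2) p)
        - (LINT p | ?P n. ?W (s1, v2) (v1, t2) p)"
      by (simp only: Bochner_Integration.integral_diff Bochner_Integration.integrable_diff int)
    finally show ?thesis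
      using sig[OF ne perm] st sq by simp
  qed
  consider "n = 0" | "n = 1" | "n = 2"
    using u by linarith
  then show ?thesis
  proof cases
    case 1
    interpret product_sigma_finite "\<lambda>_::nat. lborel :: (real \<times> real) measure"
      by (simp add: product_sigma_finite_def lborel.sigma_finite_measure_axioms)
    have "\<nu> = [1]"
      using \<nu> 1 by simp
    \<comment> \<open>The product measure over no indices is a unit point mass, the region only asks
      that \<open>v\<close> lie in the rectangle, and the weight is an empty product.\<close>
    moreover have "?L = 1"
      using 1 v by (simp add: PiM_empty lebesgue_integral_count_space_finite ordered_points_def point_weight_def)
    ultimately show ?thesis
      by simp
  next
    case 2
    have "\<nu> \<in> permutations_of_set {1, 2}"
      using \<nu> 2 by (simp add: numeral_2_eq_2 atLeastAtMostSuc_conv insert_commute)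
    then consider "\<nu> = [1,2]" | "\<nu> = [2,1]"
      by (auto simp: permutations_of_set_doubleton)
    then show ?thesis
    proof cases
      case 1 with 2 u show ?thesis by (subst max[of "[1]"]) auto
    next
      case 2 with \<open>n = 1\<close> u show ?thesis by (subst min[of "[1]"]) auto
    qed
  next
    case 3
    have I: "i = Suc 0 \<or> i = 2" if "i \<in> {Suc 0..2}" for i
      using that by auto
    have perm: "[1,2] \<in> permutations_of_set {1..n}" "[2,1] \<in> permutations_of_set {1..n}"
      using 3 by (auto simp: permutations_of_set_def)
    have ne: "u \<noteq> []"
      using u 3 by auto
    have "length \<nu> = 3" and \<nu>_set: "distinct \<nu>" "set \<nu> = {1..3}"
      using length_finite_permutations_of_set[OF \<nu>] permutations_of_setD[OF \<nu>] 3 by simp_all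
    then obtain a b c where abc: "\<nu> = [a, b, c]"
      by (auto simp: numeral_3_eq_3 length_Suc_conv)
    then have "a \<in> {1..3}" "b \<in> {1..3}" "c \<in> {1..3}"
      using \<nu>_set(2) by auto
    then have "a = 1 \<or> a = 2 \<or> a = 3" "b = 1 \<or> b = 2 \<or> b = 3" "c = 1 \<or> c = 2 \<or> c = 3"
      by auto
    \<comment> \<open>Grouped by last value: 3 is the maximum, 1 the minimum, and 2 the middle
      case.\<close>
    with abc \<nu>_set(1) consider "\<nu> = [1,2,3]" | "\<nu> = [2,1,3]" | "\<nu> = [2,3,1]" | "\<nu> = [3,2,1]"
      | "\<nu> = [1,3,2]" | "\<nu> = [3,1,2]"
      by (elim disjE) simp_all
    then show ?thesis
    proof cases
      case 1 with 3 ne perm show ?thesis by (subst max[of "[1,2]"]) (auto dest!: I simp del: atLeastAtMost_iff)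
    next
      case 2 with 3 ne perm show ?thesis by (subst max[of "[2,1]"]) (auto dest!: I simp del: atLeastAtMost_iff)
    next
      case 3 with \<open>n = 2\<close> ne perm show ?thesis by (subst min[of "[1,2]"]) (auto dest!: I simp del: atLeastAtMost_iff)
    next
      case 4 with 3 ne perm show ?thesis by (subst min[of "[2,1]"]) (auto dest!: I simp del: atLeastAtMost_iff)
    next
      case 5 with 3 show ?thesis by (subst middle[of "[1,2]"]) auto
    next
      case 6 with 3 show ?thesis by (subst middle[of "[2,1]"]) auto
    qed
  qed
qed

theorem proposition4p19:
  fixes T :: real and X :: "real \<times> real \<Rightarrow> real ^ 'd"
    and n :: nat and w :: "'d list" and \<nu> :: "nat list"
    and s1 s2 t1 t2 :: real
  assumes "T > 0"
    and "C2_square T X"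
    and "n \<le> 3"
    and "length w = n"
    and "\<nu> \<in> permutations_of_set {1..n}"
    and "(s1, s2) \<in> {0..T} \<times> {0..T}"
    and "(t1, t2) \<in> {0..T} \<times> {0..T}"
    and "s1 \<le> t1" and "s2 \<le> t2"
  shows "sig2 T X (s1, s2) (t1, t2) w \<nu> =
    of_bool (w = []) +
    of_bool (w \<noteq> []) *
      (LINT v : {s1..t1} \<times> {s2..t2} | lborel.
         sig_kernel T X (s1, s2) (t1, t2) (butlast w) \<nu> v * partial12 T (\<lambda>p. X p $ last w) v)"
proof (cases n)
  case 0
  with assms(4) show ?thesis
    by (simp add: sig2_def)
next
  case (Suc m)
  let ?box = "{s1..t1} \<times> {s2..t2}"
  let ?K = "\<lambda>v. LINT p | (\<Pi>\<^sub>M i\<in>{1..m}. lborel).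
    indicator (ordered_points (Suc m) \<nu> (s1, s2) (t1, t2)) (p(Suc m := v)) * point_weight T X (butlast w) m p"
  have w: "w \<noteq> []" "length w = Suc m"
    using assms(4) Suc by auto
  have "sig2 T X (s1, s2) (t1, t2) w \<nu> = (LINT v | lborel. ?K v * mixed_density T X (last w) v)"
    by (rule sig2_eq_integral_last_point) (use assms w Suc in auto)
  also have "\<dots> = (LINT v : ?box | lborel.
      sig_kernel T X (s1, s2) (t1, t2) (butlast w) \<nu> v * partial12 T (\<lambda>p. X p $ last w) v)"
    unfolding set_lebesgue_integral_def
  proof (rule Bochner_Integration.integral_cong[OF refl])
    fix v :: "real \<times> real"
    obtain v1 v2 where v: "v = (v1, v2)"
      by (cases v)
    show "?K v * mixed_density T X (last w) v = indicator ?box v *\<^sub>R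
      (sig_kernel T X (s1, s2) (t1, t2) (butlast w) \<nu> v * partial12 T (\<lambda>p. X p $ last w) v)"
    proof (cases "v \<in> ?box")
      case True
      then have "mixed_density T X (last w) v = partial12 T (\<lambda>p. X p $ last w) v"
        using assms(6,7) v by (auto simp: mixed_density_def indicator_def)
      moreover have "?K v = sig_kernel T X (s1, s2) (t1, t2) (butlast w) \<nu> v"
        unfolding v by (rule integral_last_section_eq_sig_kernel) (use assms w Suc True v in auto)
      ultimately show ?thesis
        using True by simp
    next
      case False
      \<comment> \<open>The region confines its last point to the rectangle, so the section over an
        outside \<open>v\<close> is empty and both integrands vanish.\<close>
      then have "p(Suc m := v) \<notin> ordered_points (Suc m) \<nu> (s1, s2) (t1, t2)" for p
      proof -
        have "v \<in> ?box" if "p(Suc m := v) \<in> ordered_points (Suc m) \<nu> (s1, s2) (t1, t2)"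
          using that unfolding ordered_points_def mem_Collect_eq
          by (elim conjE) (drule bspec[of _ _ "Suc m"], simp_all add: v)
        with False show ?thesis
          by blast
      qed
      with False show ?thesis
        by simp
    qed
  qed
  finally show ?thesis
    using w by simp
qed

end
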